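(* There exists a mapping $\mathcal{E}$ such that $\mathcal{E}\in\mathcal{N}_n$ for every $n\in\mathbb{N}$.
   Context: Formulas are given by $A ::= \bot \mid p \mid (A\to A)\mid \Box A$, where $p$ ranges over atomic propositions. A sequent is an expression $\Gamma\Rightarrow\Delta$ with $\Gamma,\Delta$ finite multisets of formulas; a comma denotes multiset union, and for $\Gamma=A_1,\dots,A_n$ we set $\Box\Gamma:=\Box A_1,\dots,\Box A_n$. The calculus $\mathsf{Grz}_\infty+\mathsf{cut}$ has initial sequents $\Gamma,p\Rightarrow p,\Delta$ ($p$ atomic) and $\Gamma,\bot\Rightarrow\Delta$, and the following rules: - $(\to_L)$: from $\Gamma,B\Rightarrow\Delta$ and $\Gamma\Rightarrow A,\Delta$ infer $\Gamma,A\to B\Rightarrow\Delta$; - $(\to_R)$: from $\Gamma,A\Rightarrow B,\Delta$ infer $\Gamma\Rightarrow A\to B,\Delta$; - $(\mathsf{refl})$: from $\Gamma,A,\Box A\Rightarrow\Delta$ infer $\Gamma,\Box A\Rightarrow\Delta$; - $(\Box)$: from $\Gamma,\Box\Pi\Rightarrow A,\Delta$ (left premise) and $\Box\Pi\Rightarrow A$ (right premise) infer $\Gamma,\Box\Pi\Rightarrow\Box A,\Delta$; - $(\mathsf{cut})$: from $\Gamma\Rightarrow A,\Delta$ and $\Gamma,A\Rightarrow\Delta$ infer $\Gamma\Rightarrow\Delta$. An $\infty$-proof is a possibly infinite tree whose nodes are marked by sequents and whose leaves are marked by initial sequents, constructed according to these rules, such that every infinite branch passes through a right premise of $(\Box)$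 infinitely many times. It is an $\infty$-proof of the sequent marking its root. $\mathcal{P}$ denotes the set of all $\infty$-proofs in $\mathsf{Grz}_\infty+\mathsf{cut}$. Binary relations $\sim_n$ on $\mathcal{P}$ ($n\in\mathbb{N}$) are defined by simultaneous induction: (1) $\pi\sim_0\tau$ for all $\pi,\tau$; (2) if $\pi$ consists only of an initial sequent, then $\pi\sim_n\pi$; (3) if $\pi,\tau$ are obtained by the same instance of $(\to_L)$ or $(\mathsf{cut})$ from $\pi',\pi''$ and $\tau',\tau''$ respectively, with $\pi'\sim_n\tau'$ and $\pi''\sim_n\tau''$, then $\pi\sim_n\tau$; (4) if $\pi,\tau$ are obtained by the same instance of $(\to_R)$ or $(\mathsf{refl})$ from $\pi'$ and $\tau'$ with $\pi'\sim_n\tau'$, then $\pi\sim_n\tau$; (5) if $\pi,\tau$ are obtained by the same instance of $(\Box)$ from $\pi',\pi''$ and $\tau',\tau''$, where $\pi',\tau'$ are the $\infty$-proofs of the left premise, with $\pi'\sim_{n+1}\tau'$ and $\pi''\sim_n\tau''$, then $\pi\sim_{n+1}\tau$. Subsets $\mathcal{P}_n\subset\mathcal{P}$ ($n\in\mathbb{N}$) are defined by simultaneous induction: (1) $\pi\in\mathcal{P}_0$ for all $\pi$; (2) if $\pi$ consists only of an initial sequent, then $\pi\in\mathcal{P}_n$; (3) if $\pi$ is obtained by $(\to_L)$ from $\pi',\pi''\in\mathcal{P}_n$, then $\pi\in\mathcal{P}_n$; (4) if $\pi$ is obtained by $(\to_R)$ or $(\mathsf{refl})$ from $\pi'\in\mathcal{P}_n$,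 then $\pi\in\mathcal{P}_n$; (5) if $\pi$ is obtained by $(\Box)$ from $\pi'$ (for the left premise) and $\pi''$ (for the right premise) with $\pi'\in\mathcal{P}_{n+1}$, $\pi''\in\mathcal{P}_n$, then $\pi\in\mathcal{P}_{n+1}$. A mapping $\mathcal{U}\colon\mathcal{P}\to\mathcal{P}$ is nonexpansive if for every $n\in\mathbb{N}$, $\pi\sim_n\tau$ implies $\mathcal{U}(\pi)\sim_n\mathcal{U}(\tau)$; it is root-preserving if it maps $\infty$-proofs to $\infty$-proofs of the same sequents. $\mathcal{N}$ is the set of all root-preserving nonexpansive mappings $\mathcal{P}\to\mathcal{P}$, and $\mathcal{N}_n:=\{\mathcal{U}\in\mathcal{N}\mid\mathcal{U}(\mathcal{P})\subset\mathcal{P}_n\}$. *)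

theory Defs
  imports "HOL-Library.Multiset"
begin

datatype 'p form =
    Bot
  | Atom 'p
  | Imp "'p form" "'p form"
  | Box "'p form"

datatype 'p sequent = Seq "'p form multiset" "'p form multiset"  (infix \<open>\<turnstile>\<close> 50)

abbreviation Boxes :: "'p form multiset \<Rightarrow> 'p form multiset" where
  "Boxes \<Pi> \<equiv> image_mset Box \<Pi>"

definition initial :: "'p sequent \<Rightarrow> bool" where
  "initial s \<longleftrightarrow>
     (\<exists>\<Gamma> p \<Delta>. s = (add_mset (Atom p) \<Gamma> \<turnstile> add_mset (Atom p) \<Delta>)) \<or>
     (\<exists>\<Gamma> \<Delta>. s = (add_mset Bot \<Gamma> \<turnstile> \<Delta>))"

datatype 'p inst =
    ImpL "'p form multiset" "'p form" "'p form" "'p form multiset"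
  | ImpR "'p form multiset" "'p form" "'p form" "'p form multiset"
  | Refl "'p form multiset" "'p form" "'p form multiset"
  | BoxR "'p form multiset" "'p form multiset" "'p form" "'p form multiset"
  | Cut "'p form multiset" "'p form" "'p form multiset"

fun concl_of :: "'p inst \<Rightarrow> 'p sequent" where
  "concl_of (ImpL \<Gamma> A B \<Delta>) = (add_mset (Imp A B) \<Gamma> \<turnstile> \<Delta>)"
| "concl_of (ImpR \<Gamma> A B \<Delta>) = (\<Gamma> \<turnstile> add_mset (Imp A B) \<Delta>)"
| "concl_of (Refl \<Gamma> A \<Delta>) = (add_mset (Box A) \<Gamma> \<turnstile> \<Delta>)"
| "concl_of (BoxR \<Gamma> \<Pi> A \<Delta>) = (\<Gamma> + Boxes \<Pi> \<turnstile> add_mset (Box A) \<Delta>)"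
| "concl_of (Cut \<Gamma> A \<Delta>) = (\<Gamma> \<turnstile> \<Delta>)"

fun prems_of :: "'p inst \<Rightarrow> 'p sequent list" where
  "prems_of (ImpL \<Gamma> A B \<Delta>) = [add_mset B \<Gamma> \<turnstile> \<Delta>, \<Gamma> \<turnstile> add_mset A \<Delta>]"
| "prems_of (ImpR \<Gamma> A B \<Delta>) = [add_mset A \<Gamma> \<turnstile> add_mset B \<Delta>]"
| "prems_of (Refl \<Gamma> A \<Delta>) = [add_mset A (add_mset (Box A) \<Gamma>) \<turnstile> \<Delta>]"
| "prems_of (BoxR \<Gamma> \<Pi> A \<Delta>) = [\<Gamma> + Boxes \<Pi> \<turnstile> add_mset A \<Delta>, Boxes \<Pi> \<turnstile> {#A#}]"
| "prems_of (Cut \<Gamma> A \<Delta>) = [\<Gamma> \<turnstile> add_mset A \<Delta>, add_mset A \<Gamma> \<turnstile> \<Delta>]"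

text \<open>
  Nodes carry only sequents. No information is lost: the premises and the conclusion of a rule
  instance determine the rule and all its parameters.
\<close>

lemma inst_unique:
  assumes "concl_of r = concl_of r'" and "prems_of r = prems_of r'"
  shows "r = r'"
proof -
  have inj: "Boxes M = Boxes N \<longleftrightarrow> M = N" for M N :: "'a form multiset"
    using multiset.inj_map[of Box] by (auto simp: inj_def)
  have ne: "Imp A B \<noteq> B" "B \<noteq> Imp A B" for A B :: "'a form"
    by (induction B arbitrary: A) auto
  have ImpR: "B = B' \<and> D = D'"
    if "add_mset (Imp A B) D = add_mset (Imp A B') D'" "add_mset B D = add_mset B' D'"
    for A B B' :: "'a form" and D D'
  proof -
    have "B = B'"
    proof (rule ccontr)
      assume "B \<noteq> B'"
      have "count (add_mset (Imp A B) D) B = count (add_mset (Imp A B') D') B"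
           "count (add_mset B D) B = count (add_mset B' D') B"
        using that by simp_all
      then show False
        using \<open>B \<noteq> B'\<close> ne by (auto split: if_splits)
    qed
    then show ?thesis using that by simp
  qed
  have Refl: "A = A' \<and> M = M'"
    if "add_mset (Box A) M = add_mset (Box A') M'"
       "add_mset A (add_mset (Box A) M) = add_mset A' (add_mset (Box A') M')"
    for A A' :: "'a form" and M M'
    using that by (metis add_mset_add_mset_same_iff add_left_imp_eq add_mset_add_single single_eq_single)
  show ?thesis
    using assms by (cases r; cases r') (auto simp: inj ne dest: ImpR Refl)
qed

codatatype 'p tree = Node (root: "'p sequent") (subtrees: "'p tree list")

definition is_initial :: "'p tree \<Rightarrow> bool" where
  "is_initial \<pi> \<longleftrightarrow> initial (root \<pi>) \<and> subtrees \<pi> = []"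

definition obtained_by :: "'p inst \<Rightarrow> 'p tree list \<Rightarrow> 'p tree \<Rightarrow> bool" where
  "obtained_by r \<pi>s \<pi> \<longleftrightarrow>
     root \<pi> = concl_of r \<and> subtrees \<pi> = \<pi>s \<and> map root \<pi>s = prems_of r"

coinductive locally_correct :: "'p tree \<Rightarrow> bool" where
  "is_initial \<pi> \<Longrightarrow> locally_correct \<pi>"
| "obtained_by r \<pi>s \<pi> \<Longrightarrow> (\<forall>\<pi>'\<in>set \<pi>s. locally_correct \<pi>') \<Longrightarrow> locally_correct \<pi>"

text \<open>
  An infinite branch is given by the subtrees \<open>b i\<close> along it together with the directions
  \<open>d i\<close> taken. The directions are needed because both premises of the box rule may be derived
  by the same tree.
\<close>

definition infinite_branch :: "'p tree \<Rightarrow> (nat \<Rightarrow> 'p tree) \<Rightarrow> (nat \<Rightarrow> nat) \<Rightarrow> bool" where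
  "infinite_branch \<pi> b d \<longleftrightarrow> b 0 = \<pi> \<and>
     (\<forall>i. d i < length (subtrees (b i)) \<and> b (Suc i) = subtrees (b i) ! d i)"

definition right_box_step :: "'p tree \<Rightarrow> nat \<Rightarrow> bool" where
  "right_box_step \<pi> k \<longleftrightarrow>
     (\<exists>\<Gamma> \<Pi> A \<Delta>. obtained_by (BoxR \<Gamma> \<Pi> A \<Delta>) (subtrees \<pi>) \<pi>) \<and> k = 1"

definition infproofs :: "'p tree set" where
  "infproofs = {\<pi>. locally_correct \<pi> \<and>
     (\<forall>b d. infinite_branch \<pi> b d \<longrightarrow> (\<exists>\<^sub>\<infinity>i. right_box_step (b i) (d i)))}"

inductive sim :: "nat \<Rightarrow> 'p tree \<Rightarrow> 'p tree \<Rightarrow> bool" where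
  sim_0: "\<pi> \<in> infproofs \<Longrightarrow> \<tau> \<in> infproofs \<Longrightarrow> sim 0 \<pi> \<tau>"
| sim_initial: "is_initial \<pi> \<Longrightarrow> sim n \<pi> \<pi>"
| sim_ImpL: "obtained_by (ImpL \<Gamma> A B \<Delta>) [\<pi>', \<pi>''] \<pi> \<Longrightarrow> obtained_by (ImpL \<Gamma> A B \<Delta>) [\<tau>', \<tau>''] \<tau> \<Longrightarrow>
    sim n \<pi>' \<tau>' \<Longrightarrow> sim n \<pi>'' \<tau>'' \<Longrightarrow> sim n \<pi> \<tau>"
| sim_Cut: "obtained_by (Cut \<Gamma> A \<Delta>) [\<pi>', \<pi>''] \<pi> \<Longrightarrow> obtained_by (Cut \<Gamma> A \<Delta>) [\<tau>', \<tau>''] \<tau> \<Longrightarrow>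
    sim n \<pi>' \<tau>' \<Longrightarrow> sim n \<pi>'' \<tau>'' \<Longrightarrow> sim n \<pi> \<tau>"
| sim_ImpR: "obtained_by (ImpR \<Gamma> A B \<Delta>) [\<pi>'] \<pi> \<Longrightarrow> obtained_by (ImpR \<Gamma> A B \<Delta>) [\<tau>'] \<tau> \<Longrightarrow>
    sim n \<pi>' \<tau>' \<Longrightarrow> sim n \<pi> \<tau>"
| sim_Refl: "obtained_by (Refl \<Gamma> A \<Delta>) [\<pi>'] \<pi> \<Longrightarrow> obtained_by (Refl \<Gamma> A \<Delta>) [\<tau>'] \<tau> \<Longrightarrow>
    sim n \<pi>' \<tau>' \<Longrightarrow> sim n \<pi> \<tau>"
| sim_BoxR: "obtained_by (BoxR \<Gamma> \<Pi> A \<Delta>) [\<pi>', \<pi>''] \<pi> \<Longrightarrow> obtained_by (BoxR \<Gamma> \<Pi> A \<Delta>) [\<tau>', \<tau>''] \<tau> \<Longrightarrow>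
    sim (Suc n) \<pi>' \<tau>' \<Longrightarrow> sim n \<pi>'' \<tau>'' \<Longrightarrow> sim (Suc n) \<pi> \<tau>"

inductive cutfree_upto :: "nat \<Rightarrow> 'p tree \<Rightarrow> bool" where
  cutfree_0: "\<pi> \<in> infproofs \<Longrightarrow> cutfree_upto 0 \<pi>"
| cutfree_initial: "is_initial \<pi> \<Longrightarrow> cutfree_upto n \<pi>"
| cutfree_ImpL: "obtained_by (ImpL \<Gamma> A B \<Delta>) [\<pi>', \<pi>''] \<pi> \<Longrightarrow>
    cutfree_upto n \<pi>' \<Longrightarrow> cutfree_upto n \<pi>'' \<Longrightarrow> cutfree_upto n \<pi>"
| cutfree_ImpR: "obtained_by (ImpR \<Gamma> A B \<Delta>) [\<pi>'] \<pi> \<Longrightarrow> cutfree_upto n \<pi>' \<Longrightarrow> cutfree_upto n \<pi>"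
| cutfree_Refl: "obtained_by (Refl \<Gamma> A \<Delta>) [\<pi>'] \<pi> \<Longrightarrow> cutfree_upto n \<pi>' \<Longrightarrow> cutfree_upto n \<pi>"
| cutfree_BoxR: "obtained_by (BoxR \<Gamma> \<Pi> A \<Delta>) [\<pi>', \<pi>''] \<pi> \<Longrightarrow>
    cutfree_upto (Suc n) \<pi>' \<Longrightarrow> cutfree_upto n \<pi>'' \<Longrightarrow> cutfree_upto (Suc n) \<pi>"

definition infproofs_upto :: "nat \<Rightarrow> 'p tree set" where
  "infproofs_upto n = {\<pi>. cutfree_upto n \<pi>}"

definition nonexpansive :: "('p tree \<Rightarrow> 'p tree) \<Rightarrow> bool" where
  "nonexpansive U \<longleftrightarrow> (\<forall>n \<pi> \<tau>. sim n \<pi> \<tau> \<longrightarrow> sim n (U \<pi>) (U \<tau>))"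

definition root_preserving :: "('p tree \<Rightarrow> 'p tree) \<Rightarrow> bool" where
  "root_preserving U \<longleftrightarrow> (\<forall>\<pi>\<in>infproofs. root (U \<pi>) = root \<pi>)"

text \<open>
  A mapping on \<^const>\<open>infproofs\<close> is represented by a total function on trees whose values
  outside \<^const>\<open>infproofs\<close> are irrelevant; \<^const>\<open>sim\<close> only relates members of
  \<^const>\<open>infproofs\<close>.
\<close>

definition nonexp_maps :: "('p tree \<Rightarrow> 'p tree) set" where
  "nonexp_maps = {U. U ` infproofs \<subseteq> infproofs \<and> root_preserving U \<and> nonexpansive U}"

definition nonexp_maps_upto :: "nat \<Rightarrow> ('p tree \<Rightarrow> 'p tree) set" where
  "nonexp_maps_upto n = {U \<in> nonexp_maps. U ` infproofs \<subseteq> infproofs_upto n}"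

end

theory Submission
  imports Defs "HOL-Library.Infinite_Set"
begin

text \<open>
  For \<open>n > 0\<close> the relation \<^const>\<open>sim\<close> \<open>n\<close> forces equal roots, and \<^const>\<open>sim\<close> \<open>0\<close> relates all
  \<open>\<infinity>\<close>-proofs. Hence any mapping that depends on the root of its argument only is nonexpansive,
  as soon as its values are \<open>\<infinity>\<close>-proofs related to themselves. So it suffices to choose, for every sequent that has an
  \<open>\<infinity>\<close>-proof with cuts, one cut-free \<open>\<infinity>\<close>-proof of it, and this choice may be made by semantic
  means, without transforming proofs.

  The semantics are finite trees, read as reflexive and transitive Kripke models. The calculus with
  cut is sound for them (\<open>infproofs_sound\<close>): a model that refutes the root of an \<open>\<infinity>\<close>-proof can be
  traced along a branch, where it moves to a proper submodel at each right premise of the box rule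
  and stays the same at all other premises. The branch cannot end in an initial sequent, so it is
  infinite and passes infinitely many right premises, against the finiteness of the model.

  Conversely, each valid sequent has a cut-free derivation of finite height whose open leaves are
  valid right premises of the box rule (\<open>valid_derivable\<close>): if the backward search for one fails, the
  right premises at which it got stuck have countermodels, and a new root with these as children
  refutes the given sequent. Since the open leaves are valid again, these derivations can be glued
  corecursively. In the resulting tree every infinite branch leaves infinitely many of the finite
  pieces, each time through a right premise.
\<close>

section \<open>Finite tree models\<close>

text \<open>
  A world is identified with the subtree above it, so that its successors are its subtrees, with
  itself included, and moving to a proper successor decreases the size.
\<close>

datatype 'p model = World (val: "'p set") (children: "'p model list")

primrec upset :: "'p model \<Rightarrow> 'p model set" where
  "upset (World V ks) = insert (World V ks) (\<Union> (set (map upset ks)))"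

primrec forces :: "'p form \<Rightarrow> 'p model \<Rightarrow> bool" where
  "forces Bot M \<longleftrightarrow> False"
| "forces (Atom p) M \<longleftrightarrow> p \<in> val M"
| "forces (Imp A B) M \<longleftrightarrow> (forces A M \<longrightarrow> forces B M)"
| "forces (Box A) M \<longleftrightarrow> (\<forall>N\<in>upset M. forces A N)"

fun refutes :: "'p model \<Rightarrow> 'p sequent \<Rightarrow> bool" where
  "refutes M (\<Gamma> \<turnstile> \<Delta>) \<longleftrightarrow> (\<forall>A\<in>#\<Gamma>. forces A M) \<and> (\<forall>B\<in>#\<Delta>. \<not> forces B M)"

definition valid :: "'p sequent \<Rightarrow> bool" where
  "valid s \<longleftrightarrow> (\<forall>M. \<not> refutes M s)"

lemma upset_refl: "M \<in> upset M"
  by (cases M) simp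

lemma upset_trans: "N \<in> upset M \<Longrightarrow> K \<in> upset N \<Longrightarrow> K \<in> upset M"
  by (induction M) auto

lemma upset_size: "N \<in> upset M \<Longrightarrow> N = M \<or> size N < size M"
proof (induction M)
  case (World V ks)
  show ?case
  proof (cases "N = World V ks")
    case False
    then obtain k where k: "k \<in> set ks" "N \<in> upset k" using World.prems by auto
    then have "size N \<le> size k" using World.IH by fastforce
    also have "size k < size (World V ks)"
      using k(1) by (simp add: less_Suc_eq_le size_list_estimation')
    finally show ?thesis by simp
  qed simp
qed

lemma forces_Box_World:
  "forces (Box A) (World V ks) \<longleftrightarrow> forces A (World V ks) \<and> (\<forall>k\<in>set ks. forces (Box A) k)"
  by auto

lemma forces_Box_mono: "forces (Box A) M \<Longrightarrow> N \<in> upset M \<Longrightarrow> forces (Box A) N"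
  using upset_trans by auto

lemma initial_iff:
  "initial (\<Gamma> \<turnstile> \<Delta>) \<longleftrightarrow> (\<exists>p. Atom p \<in># \<Gamma> \<and> Atom p \<in># \<Delta>) \<or> Bot \<in># \<Gamma>"
  unfolding initial_def
  by (metis multi_member_split sequent.inject union_single_eq_member)

lemma initial_valid: "initial s \<Longrightarrow> valid s"
  by (cases s) (auto simp: initial_iff valid_def intro: bexI[of _ Bot])

section \<open>Soundness of the calculus with cut\<close>

fun right_prem :: "'p inst \<Rightarrow> nat \<Rightarrow> bool" where
  "right_prem (BoxR \<Gamma> \<Pi> A \<Delta>) k \<longleftrightarrow> k = 1"
| "right_prem _ k \<longleftrightarrow> False"

lemma right_box_step_iff:
  assumes "obtained_by r (subtrees \<pi>) \<pi>"
  shows "right_box_step \<pi> k \<longleftrightarrow> right_prem r k"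
proof
  assume "right_box_step \<pi> k"
  then obtain \<Gamma> \<Pi> A \<Delta> where b: "obtained_by (BoxR \<Gamma> \<Pi> A \<Delta>) (subtrees \<pi>) \<pi>" and "k = 1"
    unfolding right_box_step_def by blast
  have "r = BoxR \<Gamma> \<Pi> A \<Delta>"
    using assms b by (intro inst_unique) (auto simp: obtained_by_def)
  then show "right_prem r k" using \<open>k = 1\<close> by simp
next
  assume "right_prem r k"
  then show "right_box_step \<pi> k"
    using assms unfolding right_box_step_def by (cases r) auto
qed

text \<open>
  The interesting case is the box rule: if \<open>\<box>A\<close> fails at \<open>M\<close>, then either \<open>A\<close> fails at \<open>M\<close> itself,
  which refutes the left premise, or \<open>A\<close> fails at a proper submodel, where the boxed context
  persists and which therefore refutes the right premise.
\<close>

lemma refutes_some_premise: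
  assumes "refutes M (concl_of r)"
  shows "\<exists>k<length (prems_of r). \<exists>N. refutes N (prems_of r ! k) \<and>
    (if right_prem r k then size N < size M else N = M)"
proof (cases r)
  case (ImpL \<Gamma> A B \<Delta>)
  show ?thesis
  proof (cases "forces A M")
    case True
    then show ?thesis using assms ImpL by (intro exI[of _ 0]) auto
  next
    case False
    then show ?thesis using assms ImpL by (intro exI[of _ 1]) auto
  qed
next
  case (ImpR \<Gamma> A B \<Delta>)
  then show ?thesis using assms by auto
next
  case (Refl \<Gamma> A \<Delta>)
  then show ?thesis using assms upset_refl[of M] by auto
next
  case (BoxR \<Gamma> \<Pi> A \<Delta>)
  show ?thesis
  proof (cases "forces A M")
    case False
    then show ?thesis using assms BoxR by (intro exI[of _ 0]) auto
  next
    case True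
    obtain N where N: "N \<in> upset M" "\<not> forces A N" using assms BoxR by auto
    then have "size N < size M" using True upset_size by blast
    moreover have "\<forall>B\<in>#Boxes \<Pi>. forces B N"
      using assms BoxR forces_Box_mono[OF _ N(1)] by (auto simp del: forces.simps)
    ultimately show ?thesis using N BoxR by (intro exI[of _ 1]) auto
  qed
next
  case (Cut \<Gamma> A \<Delta>)
  show ?thesis
  proof (cases "forces A M")
    case False
    then show ?thesis using assms Cut by (intro exI[of _ 0]) auto
  next
    case True
    then show ?thesis using assms Cut by (intro exI[of _ 1]) auto
  qed
qed

lemma locally_correct_refuted_step:
  assumes "locally_correct \<pi>" and "refutes M (root \<pi>)"
  shows "\<exists>k<length (subtrees \<pi>). \<exists>N. locally_correct (subtrees \<pi> ! k) \<and>
    refutes N (root (subtrees \<pi> ! k)) \<and> size N \<le> size M \<and>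
    (right_box_step \<pi> k \<longrightarrow> size N < size M)"
  using assms(1)
proof cases
  case 1
  then show ?thesis
    using assms(2) initial_valid by (auto simp: is_initial_def valid_def)
next
  case (2 r \<pi>s)
  then have ob: "obtained_by r (subtrees \<pi>) \<pi>" and "subtrees \<pi> = \<pi>s"
    by (auto simp: obtained_by_def)
  have prems: "prems_of r = map root (subtrees \<pi>)" and "concl_of r = root \<pi>"
    using ob by (auto simp: obtained_by_def)
  then obtain k N where "k < length (subtrees \<pi>)" "refutes N (root (subtrees \<pi> ! k))"
    "if right_prem r k then size N < size M else N = M"
    using refutes_some_premise[of M r] assms(2) by auto
  then show ?thesis
    using 2(2) \<open>subtrees \<pi> = \<pi>s\<close> right_box_step_iff[OF ob]
    by (intro exI[of _ k] conjI exI[of _ N]) (auto split: if_splits)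
qed

lemma antitone_nat_not_infinitely_decreasing:
  fixes f :: "nat \<Rightarrow> nat"
  assumes "\<And>i. f (Suc i) \<le> f i"
  shows "\<not> (\<exists>\<^sub>\<infinity>i. f (Suc i) < f i)"
proof
  assume inf: "\<exists>\<^sub>\<infinity>i. f (Suc i) < f i"
  obtain i0 where i0: "\<And>i. f i0 \<le> f i"
    using ex_has_least_nat[of "\<lambda>_. True" _ f] by auto
  obtain i where "i \<ge> i0" "f (Suc i) < f i"
    using inf by (auto simp: INFM_nat_le)
  moreover have "f i \<le> f i0"
    using lift_Suc_antimono_le[of f] assms \<open>i \<ge> i0\<close> by auto
  ultimately show False using i0[of "Suc i"] by simp
qed

theorem infproofs_sound:
  assumes "\<pi> \<in> infproofs"
  shows "valid (root \<pi>)"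
proof (rule ccontr)
  assume "\<not> valid (root \<pi>)"
  then obtain M where M: "refutes M (root \<pi>)" by (auto simp: valid_def)
  have lc: "locally_correct \<pi>" using assms by (simp add: infproofs_def)
  let ?P = "\<lambda>(\<tau>, N). locally_correct \<tau> \<and> refutes N (root \<tau>)"
  let ?Q = "\<lambda>(\<tau>, N) (\<tau>', N') k. k < length (subtrees \<tau>) \<and> \<tau>' = subtrees \<tau> ! k \<and>
     size N' \<le> size N \<and> (right_box_step \<tau> k \<longrightarrow> size N' < size N)"
  have "\<exists>f. \<forall>i::nat. (?P (f i) \<and> (i = 0 \<longrightarrow> f i = (\<pi>, M))) \<and> (\<exists>k. ?Q (f i) (f (Suc i)) k)"
  proof (rule dependent_nat_choice)
    show "\<exists>x. ?P x \<and> (0 = 0 \<longrightarrow> x = (\<pi>, M))" using lc M by auto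
  next
    fix x :: "'a tree \<times> 'a model" and n :: nat
    assume "?P x \<and> (n = 0 \<longrightarrow> x = (\<pi>, M))"
    then show "\<exists>y. (?P y \<and> (Suc n = 0 \<longrightarrow> y = (\<pi>, M))) \<and> (\<exists>k. ?Q x y k)"
      using locally_correct_refuted_step[of "fst x" "snd x"] by (simp add: split_beta) blast
  qed
  then obtain f where f0: "f 0 = (\<pi>, M)" and "\<forall>i. \<exists>k. ?Q (f i) (f (Suc i)) k" by blast
  then have "\<exists>d. \<forall>i. ?Q (f i) (f (Suc i)) (d i)" by (intro choice)
  then obtain d where d: "\<And>i. ?Q (f i) (f (Suc i)) (d i)" by blast
  have "infinite_branch \<pi> (fst \<circ> f) d"
    using f0 d by (auto simp: infinite_branch_def split_beta)
  then have "\<exists>\<^sub>\<infinity>i. right_box_step (fst (f i)) (d i)"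
    using assms unfolding infproofs_def by fastforce
  then have "\<exists>\<^sub>\<infinity>i. size (snd (f (Suc i))) < size (snd (f i))"
    by (rule INFM_mono) (use d in \<open>auto simp: split_beta\<close>)
  moreover have "size (snd (f (Suc i))) \<le> size (snd (f i))" for i
    using d[of i] by (auto simp: split_beta)
  ultimately show False
    using antitone_nat_not_infinitely_decreasing[of "\<lambda>i. size (snd (f i))"] by blast
qed

section \<open>Cut-free derivations of valid sequents\<close>

fun is_cut :: "'p inst \<Rightarrow> bool" where
  "is_cut (Cut \<Gamma> A \<Delta>) \<longleftrightarrow> True"
| "is_cut _ \<longleftrightarrow> False"

text \<open>
  Finite cut-free derivations with valid right premises of the box rule as open leaves. The index
  bounds the height; it is what later makes the choice of a last rule at each sequent well-founded.
\<close>

inductive derivable :: "nat \<Rightarrow> 'p sequent \<Rightarrow> bool" where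
  initial: "initial s \<Longrightarrow> derivable n s"
| rule: "concl_of r = s \<Longrightarrow> \<not> is_cut r \<Longrightarrow>
    \<forall>k<length (prems_of r).
      (right_prem r k \<longrightarrow> valid (prems_of r ! k)) \<and>
      (\<not> right_prem r k \<longrightarrow> (\<exists>m<n. derivable m (prems_of r ! k))) \<Longrightarrow>
    derivable n s"

definition weight :: "'p form multiset \<Rightarrow> 'p form multiset \<Rightarrow> nat" where
  "weight \<Gamma> \<Delta> = (\<Sum>A\<in>#\<Gamma>. size A) + (\<Sum>A\<in>#\<Delta>. size A)"

text \<open>
  Reflexivity keeps its principal formula, so it must not be applied twice to the same one. The
  search therefore keeps the boxed formulas \<open>\<box>\<Sigma>\<close> to which it was applied apart from \<open>\<Gamma>\<close>, and
  countermodels are required to satisfy \<open>\<box>\<Sigma>\<close> only at the children of the root. The rest of \<open>\<box>\<Sigma>\<close>,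
  that \<open>\<Sigma>\<close> holds at the root, was moved to \<open>\<Gamma>\<close> when reflexivity was applied.
\<close>

definition secured ::
    "'p form multiset \<Rightarrow> 'p form multiset \<Rightarrow> 'p form multiset \<Rightarrow> bool" where
  "secured \<Gamma> \<Sigma> \<Delta> \<longleftrightarrow> (\<forall>V ks. (\<forall>B\<in>#\<Sigma>. \<forall>k\<in>set ks. forces (Box B) k) \<longrightarrow>
     \<not> refutes (World V ks) (\<Gamma> \<turnstile> \<Delta>))"

text \<open>
  Once \<open>\<Gamma>\<close> consists of atoms and \<open>\<Delta>\<close> of atoms, falsum and boxed formulas, and no right premise
  \<open>\<box>\<Sigma> \<Rightarrow> A\<close> is valid for a formula \<open>\<box>A\<close> in \<open>\<Delta>\<close>, countermodels of all these premises become
  the children of a new world at which just the atoms of \<open>\<Gamma>\<close> hold.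
\<close>

lemma saturated_not_secured:
  assumes \<Gamma>: "\<And>A. A \<in># \<Gamma> \<Longrightarrow> \<exists>p. A = Atom p"
    and \<Delta>: "\<And>A B. Imp A B \<notin># \<Delta>"
    and disj: "\<And>p. Atom p \<in># \<Gamma> \<Longrightarrow> Atom p \<notin># \<Delta>"
    and right: "\<And>A. Box A \<in># \<Delta> \<Longrightarrow> \<not> valid (Boxes \<Sigma> \<turnstile> {#A#})"
  shows "\<not> secured \<Gamma> \<Sigma> \<Delta>"
proof -
  have "\<forall>A\<in>{A. Box A \<in># \<Delta>}. \<exists>M. refutes M (Boxes \<Sigma> \<turnstile> {#A#})"
    using right by (auto simp: valid_def simp del: refutes.simps)
  then obtain m where m: "\<And>A. Box A \<in># \<Delta> \<Longrightarrow> refutes (m A) (Boxes \<Sigma> \<turnstile> {#A#})"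
    by (metis mem_Collect_eq)
  have "{A. Box A \<in># \<Delta>} = Box -` set_mset \<Delta>" by auto
  then have "finite {A. Box A \<in># \<Delta>}"
    by (simp add: finite_vimageI inj_def)
  then obtain ks where ks: "set ks = m ` {A. Box A \<in># \<Delta>}"
    by (metis finite_imageI finite_list)
  let ?M = "World {p. Atom p \<in># \<Gamma>} ks"
  have "\<forall>B\<in>#\<Sigma>. \<forall>k\<in>set ks. forces (Box B) k"
  proof (intro ballI)
    fix B k assume "B \<in># \<Sigma>" "k \<in> set ks"
    then obtain A where "Box A \<in># \<Delta>" "k = m A" using ks by auto
    then show "forces (Box B) k"
      using m[of A] \<open>B \<in># \<Sigma>\<close> by (auto simp del: forces.simps)
  qed
  moreover have "forces A ?M" if "A \<in># \<Gamma>" for A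
    using \<Gamma>[OF that] that by auto
  moreover have "\<not> forces A ?M" if "A \<in># \<Delta>" for A
  proof (cases A)
    case (Box B)
    then have "m B \<in> set ks" "\<not> forces B (m B)" using that m ks by auto
    then show ?thesis using Box upset_refl[of "m B"] by auto
  qed (use that \<Delta> disj in auto)
  ultimately show ?thesis
    unfolding secured_def refutes.simps by blast
qed

text \<open>
  Apart from the right premise of the box rule, all premises of cut-free rules have smaller weight,
  once the formula to which reflexivity was applied is moved to \<open>\<Sigma>\<close>. They inherit being secured
  from the conclusion: a countermodel of such a premise is also one of the conclusion. So the box
  rule is applied as soon as its right premise is valid, and no backtracking occurs.
\<close>

lemma secured_derivable:
  "secured \<Gamma> \<Sigma> \<Delta> \<Longrightarrow> derivable (weight \<Gamma> \<Delta>) (\<Gamma> + Boxes \<Sigma> \<turnstile> \<Delta>)"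
proof (induction "weight \<Gamma> \<Delta>" arbitrary: \<Gamma> \<Sigma> \<Delta> rule: less_induct)
  case less
  let ?goal = "derivable (weight \<Gamma> \<Delta>) (\<Gamma> + Boxes \<Sigma> \<turnstile> \<Delta>)"
  have main: "\<exists>m<weight \<Gamma> \<Delta>. derivable m (\<Gamma>' + Boxes \<Sigma>' \<turnstile> \<Delta>')"
    if "secured \<Gamma>' \<Sigma>' \<Delta>'" "weight \<Gamma>' \<Delta>' < weight \<Gamma> \<Delta>"
    for \<Gamma>' \<Sigma>' \<Delta>' :: "'a form multiset"
    using less.hyps[OF that(2,1)] that(2) by blast
  consider (ImpL) A B \<Gamma>' where "\<Gamma> = add_mset (Imp A B) \<Gamma>'"
    | (Refl) A \<Gamma>' where "\<Gamma> = add_mset (Box A) \<Gamma>'"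
    | (Bot) "Bot \<in># \<Gamma>"
    | (ImpR) A B \<Delta>' where "\<Delta> = add_mset (Imp A B) \<Delta>'"
    | (ax) p where "Atom p \<in># \<Gamma>" "Atom p \<in># \<Delta>"
    | (BoxR) A \<Delta>' where "\<Delta> = add_mset (Box A) \<Delta>'" "valid (Boxes \<Sigma> \<turnstile> {#A#})"
    | (sat) "\<And>A B. Imp A B \<notin># \<Gamma>" "\<And>A. Box A \<notin># \<Gamma>" "Bot \<notin># \<Gamma>"
        "\<And>A B. Imp A B \<notin># \<Delta>"
        "\<And>p. Atom p \<in># \<Gamma> \<Longrightarrow> Atom p \<notin># \<Delta>"
        "\<And>A. Box A \<in># \<Delta> \<Longrightarrow> \<not> valid (Boxes \<Sigma> \<turnstile> {#A#})"
    by (blast dest: multi_member_split)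
  then show ?goal
  proof cases
    case ImpL
    have "secured (add_mset B \<Gamma>') \<Sigma> \<Delta>" "secured \<Gamma>' \<Sigma> (add_mset A \<Delta>)"
      using less.prems unfolding ImpL secured_def by (auto simp del: forces.simps(4))
    then have "\<exists>m<weight \<Gamma> \<Delta>. derivable m (add_mset B \<Gamma>' + Boxes \<Sigma> \<turnstile> \<Delta>)"
      "\<exists>m<weight \<Gamma> \<Delta>. derivable m (\<Gamma>' + Boxes \<Sigma> \<turnstile> add_mset A \<Delta>)"
      by (intro main; simp add: weight_def ImpL)+
    then show ?thesis
      by (intro derivable.rule[of "ImpL (\<Gamma>' + Boxes \<Sigma>) A B \<Delta>"])
        (auto simp: ImpL less_Suc_eq nth_Cons')
  next
    case Refl
    have "secured (add_mset A \<Gamma>') (add_mset A \<Sigma>) \<Delta>"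
      using less.prems unfolding Refl secured_def
      by (auto simp del: forces.simps(4) simp: forces_Box_World)
    then have "\<exists>m<weight \<Gamma> \<Delta>. derivable m (add_mset A \<Gamma>' + Boxes (add_mset A \<Sigma>) \<turnstile> \<Delta>)"
      by (intro main) (auto simp: weight_def Refl)
    then show ?thesis
      by (intro derivable.rule[of "Refl (\<Gamma>' + Boxes \<Sigma>) A \<Delta>"])
        (auto simp: Refl add_mset_commute)
  next
    case Bot
    then show ?thesis
      by (auto intro!: derivable.initial simp: initial_iff)
  next
    case ImpR
    have "secured (add_mset A \<Gamma>) \<Sigma> (add_mset B \<Delta>')"
      using less.prems unfolding ImpR secured_def by (auto simp del: forces.simps(4))
    then have "\<exists>m<weight \<Gamma> \<Delta>. derivable m (add_mset A \<Gamma> + Boxes \<Sigma> \<turnstile> add_mset B \<Delta>')"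
      by (intro main) (auto simp: weight_def ImpR)
    then show ?thesis
      by (intro derivable.rule[of "ImpR (\<Gamma> + Boxes \<Sigma>) A B \<Delta>'"]) (auto simp: ImpR)
  next
    case ax
    then show ?thesis
      by (auto intro!: derivable.initial simp: initial_iff)
  next
    case BoxR
    have "secured \<Gamma> \<Sigma> (add_mset A \<Delta>')"
      using less.prems unfolding BoxR secured_def
      by (auto simp del: forces.simps(4) simp: forces_Box_World)
    then have "\<exists>m<weight \<Gamma> \<Delta>. derivable m (\<Gamma> + Boxes \<Sigma> \<turnstile> add_mset A \<Delta>')"
      by (intro main) (auto simp: weight_def BoxR)
    then show ?thesis
      using BoxR(2) by (intro derivable.rule[of "BoxR \<Gamma> \<Sigma> A \<Delta>'"])
        (auto simp: BoxR(1) less_Suc_eq nth_Cons')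
  next
    case sat
    have "\<exists>p. A = Atom p" if "A \<in># \<Gamma>" for A
      using that sat(1-3) by (cases A) auto
    then show ?thesis using saturated_not_secured[of \<Gamma> \<Delta> \<Sigma>] sat(4-) less.prems by blast
  qed
qed

corollary valid_derivable:
  assumes "valid s"
  shows "\<exists>n. derivable n s"
proof -
  obtain \<Gamma> \<Delta> where s: "s = (\<Gamma> \<turnstile> \<Delta>)" by (cases s)
  then have "secured \<Gamma> {#} \<Delta>" using assms by (simp add: secured_def valid_def)
  then show ?thesis using secured_derivable[of \<Gamma> "{#}" \<Delta>] s by auto
qed

section \<open>Gluing the derivations\<close>

definition rank :: "'p sequent \<Rightarrow> nat" where
  "rank s = (LEAST n. derivable n s)"

definition progresses :: "'p sequent \<Rightarrow> 'p inst \<Rightarrow> bool" where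
  "progresses s r \<longleftrightarrow> concl_of r = s \<and> \<not> is_cut r \<and>
     (\<forall>k<length (prems_of r). (\<exists>n. derivable n (prems_of r ! k)) \<and>
        (\<not> right_prem r k \<longrightarrow> rank (prems_of r ! k) < rank s))"

definition last_rule :: "'p sequent \<Rightarrow> 'p inst" where
  "last_rule s = (SOME r. progresses s r)"

primcorec canonical :: "'p sequent \<Rightarrow> 'p tree" where
  "canonical s = Node s (if initial s then [] else map canonical (prems_of (last_rule s)))"

lemma last_rule_progresses:
  assumes "derivable n s" and "\<not> initial s"
  shows "progresses s (last_rule s)"
proof -
  have "derivable (rank s) s" unfolding rank_def using assms(1) by (rule LeastI)
  then have "\<exists>r. progresses s r"
  proof cases
    case (rule r)
    have "(\<exists>n. derivable n (prems_of r ! k)) \<and>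
        (\<not> right_prem r k \<longrightarrow> rank (prems_of r ! k) < rank s)" if k: "k < length (prems_of r)" for k
    proof (cases "right_prem r k")
      case True
      then show ?thesis using rule(3) k valid_derivable by blast
    next
      case False
      then obtain m where m: "m < rank s" "derivable m (prems_of r ! k)"
        using rule(3) k by blast
      then have "rank (prems_of r ! k) \<le> m" unfolding rank_def by (intro Least_le)
      then show ?thesis using m by auto
    qed
    then show ?thesis using rule(1,2) unfolding progresses_def by blast
  qed (use assms(2) in blast)
  then show ?thesis unfolding last_rule_def by (rule someI_ex)
qed

lemma canonical_obtained_by:
  assumes "derivable n s" and "\<not> initial s"
  shows "obtained_by (last_rule s) (map canonical (prems_of (last_rule s))) (canonical s)"
proof -
  have "map (root \<circ> canonical) xs = xs" for xs :: "'a sequent list"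
    by (induction xs) auto
  then show ?thesis
    using last_rule_progresses[OF assms] assms(2)
    by (simp add: obtained_by_def progresses_def canonical.code)
qed

lemma canonical_locally_correct:
  assumes "derivable n s"
  shows "locally_correct (canonical s)"
proof -
  have "\<exists>s n. canonical s = \<pi> \<and> derivable n s \<Longrightarrow> locally_correct \<pi>" for \<pi> :: "'a tree"
  proof (coinduction arbitrary: \<pi>)
    case locally_correct
    then obtain s n where s: "\<pi> = canonical s" "derivable n s" by blast
    show ?case
    proof (cases "initial s")
      case True
      then show ?thesis using s by (simp add: is_initial_def)
    next
      case False
      have "\<forall>p\<in>set (prems_of (last_rule s)). \<exists>n. derivable n p"
        using last_rule_progresses[OF s(2) False] by (auto simp: progresses_def in_set_conv_nth)
      then show ?thesis using canonical_obtained_by[OF s(2) False] s(1)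
        by (intro disjI2 exI[of _ "last_rule s"]
            exI[of _ "map canonical (prems_of (last_rule s))"] exI[of _ \<pi>]) auto
    qed
  qed
  then show ?thesis using assms by blast
qed

text \<open>
  On a branch, the rank of the sequents strictly decreases except at right premises of the box rule.
\<close>

lemma canonical_infproofs:
  assumes "derivable n s"
  shows "canonical s \<in> infproofs"
proof -
  have "\<exists>\<^sub>\<infinity>i. right_box_step (b i) (d i)" if br: "infinite_branch (canonical s) b d" for b d
  proof (rule ccontr)
    assume "\<not> ?thesis"
    then obtain N where N: "\<And>i. i \<ge> N \<Longrightarrow> \<not> right_box_step (b i) (d i)"
      by (auto simp: INFM_nat_le)
    have d: "d i < length (subtrees (b i))" and b: "b (Suc i) = subtrees (b i) ! d i" for i
      using br by (auto simp: infinite_branch_def)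
    have step: "\<exists>m. derivable m (root (b (Suc i)))"
        "canonical (root (b (Suc i))) = b (Suc i)"
        "\<not> right_box_step (b i) (d i) \<longrightarrow> rank (root (b (Suc i))) < rank (root (b i))"
      if inv: "\<exists>m. derivable m (root (b i))" "canonical (root (b i)) = b i" for i
    proof -
      let ?s = "root (b i)" and ?r = "last_rule (root (b i))"
      have ni: "\<not> initial ?s"
      proof
        assume "initial ?s"
        then have "subtrees (canonical ?s) = []" by simp
        then show False using d[of i] inv(2) by simp
      qed
      then have st: "subtrees (b i) = map canonical (prems_of ?r)"
        using canonical.sel(2)[of ?s] inv(2) by simp
      have pr: "progresses ?s ?r"
        using last_rule_progresses ni inv(1) by blast
      have ob: "obtained_by ?r (subtrees (b i)) (b i)"
        using canonical_obtained_by[of _ ?s] ni inv st by auto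
      have di: "d i < length (prems_of ?r)" using d[of i] st by simp
      then have bs: "b (Suc i) = canonical (prems_of ?r ! d i)" using b[of i] st by simp
      then have rb: "root (b (Suc i)) = prems_of ?r ! d i" by simp
      show "\<exists>m. derivable m (root (b (Suc i)))" "canonical (root (b (Suc i))) = b (Suc i)"
        "\<not> right_box_step (b i) (d i) \<longrightarrow> rank (root (b (Suc i))) < rank (root (b i))"
        using pr di bs rb right_box_step_iff[OF ob] by (auto simp: progresses_def)
    qed
    have inv: "(\<exists>m. derivable m (root (b i))) \<and> canonical (root (b i)) = b i" for i
    proof (induction i)
      case 0
      then show ?case using br assms by (auto simp: infinite_branch_def)
    next
      case (Suc i)
      then show ?case using step by blast
    qed
    have "rank (root (b (Suc (N + i)))) < rank (root (b (N + i)))" for i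
      using step(3)[of "N + i"] inv N[of "N + i"] by auto
    then show False
      using antitone_nat_not_infinitely_decreasing[of "\<lambda>i. rank (root (b (N + i)))"]
      by (auto simp: less_imp_le)
  qed
  then show ?thesis
    using canonical_locally_correct[OF assms] by (auto simp: infproofs_def)
qed

lemma canonical_cutfree:
  "derivable m s \<Longrightarrow> cutfree_upto n (canonical s)"
proof (induction n arbitrary: m s)
  case 0
  then show ?case by (intro cutfree_0 canonical_infproofs)
next
  case (Suc n)
  note outer = Suc.IH
  from Suc.prems show ?case
  proof (induction "rank s" arbitrary: m s rule: less_induct)
    case less
    show ?case
    proof (cases "initial s")
      case True
      then show ?thesis by (intro cutfree_initial) (simp add: is_initial_def)
    next
      case False
      let ?r = "last_rule s"
      note ob = canonical_obtained_by[OF less.prems False]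
      have pr: "progresses s ?r" by (rule last_rule_progresses[OF less.prems False])
      have main: "cutfree_upto (Suc n) (canonical (prems_of ?r ! k))"
        if "k < length (prems_of ?r)" "\<not> right_prem ?r k" for k
        using that pr less.hyps unfolding progresses_def by blast
      have right: "cutfree_upto n (canonical (prems_of ?r ! k))" if "k < length (prems_of ?r)" for k
        using that pr outer unfolding progresses_def by blast
      show ?thesis
      proof (cases ?r)
        case (ImpL \<Gamma> A B \<Delta>)
        then show ?thesis using ob main[of 0] main[of 1] by (auto intro: cutfree_ImpL)
      next
        case (ImpR \<Gamma> A B \<Delta>)
        then show ?thesis using ob main[of 0] by (auto intro: cutfree_ImpR)
      next
        case (Refl \<Gamma> A \<Delta>)
        then show ?thesis using ob main[of 0] by (auto intro: cutfree_Refl)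
      next
        case (BoxR \<Gamma> \<Pi> A \<Delta>)
        then show ?thesis using ob main[of 0] right[of 1] by (auto intro: cutfree_BoxR)
      next
        case (Cut \<Gamma> A \<Delta>)
        then show ?thesis using pr by (simp add: progresses_def)
      qed
    qed
  qed
qed

section \<open>Cut elimination\<close>

lemma cutfree_sim_refl: "cutfree_upto n \<pi> \<Longrightarrow> sim n \<pi> \<pi>"
  by (induction rule: cutfree_upto.induct) (auto intro: sim.intros)

lemma sim_Suc_root: "sim (Suc n) \<pi> \<tau> \<Longrightarrow> root \<pi> = root \<tau>"
  by (cases rule: sim.cases) (auto simp: obtained_by_def)

theorem lemma4p8:
  "\<exists>E :: 'p tree \<Rightarrow> 'p tree. \<forall>n. E \<in> nonexp_maps_upto n"
proof -
  \<comment> \<open>Trees with an invalid root are sent to the proof of an initial sequent, so that all values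
    are \<open>\<infinity>\<close>-proofs and hence related by \<^const>\<open>sim\<close> \<open>0\<close>, whatever the arguments are.\<close>
  let ?t = "\<lambda>s :: 'p sequent. if valid s then s else ({#Bot#} \<turnstile> {#})"
  define E :: "'p tree \<Rightarrow> 'p tree" where "E \<pi> = canonical (?t (root \<pi>))" for \<pi>
  have "valid (?t s)" for s
    using initial_valid[of "{#Bot#} \<turnstile> {#}"] by (auto simp: initial_iff)
  then have der: "\<exists>m. derivable m (?t s)" for s
    using valid_derivable by blast
  have inf: "E \<pi> \<in> infproofs" and cutfree: "cutfree_upto n (E \<pi>)" for \<pi> n
    using der[of "root \<pi>"] canonical_infproofs canonical_cutfree unfolding E_def by blast+
  have "root_preserving E"
    unfolding root_preserving_def E_def using infproofs_sound by auto
  moreover have "sim n (E \<pi>) (E \<tau>)" if "sim n \<pi> \<tau>" for n \<pi> \<tau>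
  proof (cases n)
    case 0
    then show ?thesis using inf by (auto intro: sim_0)
  next
    case (Suc k)
    then have "E \<pi> = E \<tau>" using that sim_Suc_root unfolding E_def by metis
    then show ?thesis using cutfree_sim_refl[OF cutfree] by simp
  qed
  ultimately show ?thesis
    using inf cutfree
    by (intro exI[of _ E])
      (auto simp: nonexp_maps_upto_def nonexp_maps_def nonexpansive_def infproofs_upto_def)
qed

end
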